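(* For $k\ge1$ let $f_k:\{0,1\}^{2^k-1}\to\{0,1\}$ be the function computed by the following decision tree: a full binary tree of depth $k$ whose $2^k-1$ internal nodes each query a distinct variable, where at each node the left child is followed when the queried variable is $0$ and the right child when it is $1$, and each internal node at the deepest level $k$ has left leaf child labeled $0$ and right leaf child labeled $1$. Then for every $k\ge1$, $\mathsf{alt}(f_k)=2^{\mathsf{DT}(f_k)}-1$.
   Context: $\mathsf{alt}(f)$ is the maximum, over chains $0^n=x_0\prec x_1\prec\dots\prec x_n=1^n$ of distinct inputs (with $\prec$ the coordinatewise order), of the number of $i$ with $f(x_{i-1})\ne f(x_i)$. $\mathsf{DT}(f)$ is the minimum depth of a deterministic decision tree computing $f$. *)

theory Defs
  imports Main
begin

text \<open>
  The cube \<open>{0,1}^n\<close> is the set of Boolean lists of length \<open>n\<close>, coordinates being indexed by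
  \<open>0, \<dots>, n - 1\<close>. A Boolean function on \<open>n\<close> variables is a function on lists of which only the
  values on the cube matter; the arity \<open>n\<close> is therefore an explicit argument below.
\<close>

definition cube :: "nat \<Rightarrow> bool list set" where
  "cube n = {x. length x = n}"

definition strictly_below :: "bool list \<Rightarrow> bool list \<Rightarrow> bool" (infix "\<prec>" 50) where
  "x \<prec> y \<longleftrightarrow> list_all2 (\<le>) x y \<and> x \<noteq> y"

definition is_chain :: "nat \<Rightarrow> (nat \<Rightarrow> bool list) \<Rightarrow> bool" where
  "is_chain n x \<longleftrightarrow>
     (\<forall>i\<le>n. x i \<in> cube n) \<and> x 0 = replicate n False \<and> x n = replicate n True \<and>
     (\<forall>i\<in>{1..n}. x (i - 1) \<prec> x i)"

definition alt :: "nat \<Rightarrow> (bool list \<Rightarrow> bool) \<Rightarrow> nat" where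
  "alt n f = Max {card {i \<in> {1..n}. f (x (i - 1)) \<noteq> f (x i)} | x. is_chain n x}"

text \<open>In \<open>Query i l r\<close> the subtree \<open>l\<close> is followed when variable \<open>i\<close> is \<open>0\<close>, and \<open>r\<close> when it is \<open>1\<close>.\<close>

datatype dtree = Leaf bool | Query nat dtree dtree

fun eval_tree :: "dtree \<Rightarrow> bool list \<Rightarrow> bool" where
  "eval_tree (Leaf b) x = b"
| "eval_tree (Query i l r) x = (if x ! i then eval_tree r x else eval_tree l x)"

fun depth :: "dtree \<Rightarrow> nat" where
  "depth (Leaf b) = 0"
| "depth (Query i l r) = Suc (max (depth l) (depth r))"

fun queries :: "dtree \<Rightarrow> nat list" where
  "queries (Leaf b) = []"
| "queries (Query i l r) = i # queries l @ queries r"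

definition computes :: "nat \<Rightarrow> dtree \<Rightarrow> (bool list \<Rightarrow> bool) \<Rightarrow> bool" where
  "computes n t f \<longleftrightarrow> set (queries t) \<subseteq> {..<n} \<and> (\<forall>x\<in>cube n. eval_tree t x = f x)"

definition DT :: "nat \<Rightarrow> (bool list \<Rightarrow> bool) \<Rightarrow> nat" where
  "DT n f = (LEAST d. \<exists>t. computes n t f \<and> depth t = d)"

text \<open>
  Full binary trees with \<open>k \<ge> 1\<close> levels of internal nodes, the deepest of which have a left leaf
  labelled \<open>0\<close> and a right leaf labelled \<open>1\<close>.
\<close>

inductive full_tree :: "nat \<Rightarrow> dtree \<Rightarrow> bool" where
  bottom: "full_tree 1 (Query i (Leaf False) (Leaf True))"
| level: "full_tree k l \<Longrightarrow> full_tree k r \<Longrightarrow> full_tree (Suc k) (Query i l r)"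

text \<open>
  The assignment of distinct variables to the nodes is left open, so \<open>f\<^sub>k\<close> is determined only up
  to a permutation of the variables: \<open>is_fk k f\<close> says that \<open>f\<close> is \<open>f\<^sub>k\<close> for some such assignment.
\<close>

definition is_fk :: "nat \<Rightarrow> (bool list \<Rightarrow> bool) \<Rightarrow> bool" where
  "is_fk k f \<longleftrightarrow> (\<exists>t. full_tree k t \<and> distinct (queries t) \<and> computes (2 ^ k - 1) t f)"

lemma full_tree_exists:
  assumes "k \<ge> 1"
  shows "\<exists>t. full_tree k t \<and> distinct (queries t) \<and> set (queries t) \<subseteq> {a..<a + (2 ^ k - 1)}"
  using assms
proof (induction k arbitrary: a rule: nat_induct_at_least)
  case base
  show ?case
    by (rule exI[of _ "Query a (Leaf False) (Leaf True)"]) (auto intro: full_tree.bottom[simplified])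
next
  case (Suc k)
  obtain l where l: "full_tree k l" "distinct (queries l)"
      "set (queries l) \<subseteq> {Suc a..<Suc a + (2 ^ k - 1)}"
    using Suc.IH by blast
  obtain r where r: "full_tree k r" "distinct (queries r)"
      "set (queries r) \<subseteq> {a + 2 ^ k..<a + 2 ^ k + (2 ^ k - 1)}"
    using Suc.IH by blast
  have p: "(2::nat) ^ k \<ge> 1" by simp
  have "Suc a + (2 ^ k - 1) = a + 2 ^ k" using p by linarith
  with l have l3: "set (queries l) \<subseteq> {Suc a..<a + 2 ^ k}" by simp
  have e: "a + (2 ^ Suc k - 1) = a + 2 ^ k + (2 ^ k - 1)" using p by simp
  show ?case
  proof (rule exI[of _ "Query a l r"], intro conjI)
    show "full_tree (Suc k) (Query a l r)" using l r by (auto intro: full_tree.level)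
    show "distinct (queries (Query a l r))" using l(2) l3 r(2,3) p by fastforce
    show "set (queries (Query a l r)) \<subseteq> {a..<a + (2 ^ Suc k - 1)}"
      unfolding e
    proof
      fix x assume "x \<in> set (queries (Query a l r))"
      then have "x = a \<or> x \<in> {Suc a..<a + 2 ^ k} \<or> x \<in> {a + 2 ^ k..<a + 2 ^ k + (2 ^ k - 1)}"
        using l3 r(3) by auto
      then show "x \<in> {a..<a + 2 ^ k + (2 ^ k - 1)}"
        using p unfolding atLeastLessThan_iff by linarith
    qed
  qed
qed

lemma is_fk_exists:
  assumes "k \<ge> 1"
  shows "\<exists>f. is_fk k f"
  using full_tree_exists[OF assms, of 0] unfolding is_fk_def computes_def
  by (auto simp: atLeast0LessThan)

end

theory Submission imports Defs begin

text \<open>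
  Number the leaves of a decision tree from left to right. Raising variables can only move the
  reached leaf to the right, so along a chain the function alternates less often than the tree has
  leaves; hence a chain with \<open>a\<close> alternations forces depth at least \<open>log\<^sub>2 (a + 1)\<close>.
  For \<open>f\<^sub>k\<close>, switching on the variables in the in-order of the defining tree visits all
  \<open>2^k\<close> leaves one after another. Their labels alternate, so every step of this chain is an
  alternation, which determines both \<open>alt\<close> and \<open>DT\<close>.
\<close>

text \<open>
  The offset \<open>2 ^ depth l\<close> may exceed the number of leaves of \<open>l\<close>: the numbering has gaps if the
  tree is not full.
\<close>

fun leaf_index :: "dtree \<Rightarrow> bool list \<Rightarrow> nat" where
  "leaf_index (Leaf b) x = 0"
| "leaf_index (Query i l r) x = (if x ! i then 2 ^ depth l + leaf_index r x else leaf_index l x)"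

lemma leaf_index_less: "leaf_index t x < 2 ^ depth t"
proof (induction t)
  case (Query i l r)
  have "(2::nat) ^ depth l \<le> 2 ^ max (depth l) (depth r)"
    and "(2::nat) ^ depth r \<le> 2 ^ max (depth l) (depth r)"
    by (simp_all only: power_increasing one_le_numeral max.cobounded1 max.cobounded2)
  then have "2 ^ depth l + leaf_index r x < 2 * 2 ^ max (depth l) (depth r)"
    and "leaf_index l x < 2 * 2 ^ max (depth l) (depth r)"
    using Query by linarith+
  then show ?case by simp
qed simp

text \<open>Where the two paths part, \<open>x\<close> goes left and \<open>y\<close> goes right,
  and the offset \<open>2 ^ depth l\<close> exceeds every index inside \<open>l\<close>.\<close>

lemma leaf_index_mono:
  assumes "\<forall>i\<in>set (queries t). x ! i \<le> y ! i"
  shows "leaf_index t x \<le> leaf_index t y"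
  using assms
proof (induction t)
  case (Query i l r)
  have "leaf_index l x < 2 ^ depth l" by (rule leaf_index_less)
  then show ?case using Query by auto
qed simp

text \<open>Indices in the left subtree stay below the offset of the right one, so equal indices
  force the same branch at every node.\<close>

lemma eval_tree_cong_leaf_index:
  "leaf_index t x = leaf_index t y \<Longrightarrow> eval_tree t x = eval_tree t y"
proof (induction t)
  case (Query i l r)
  have "leaf_index l x < 2 ^ depth l" "leaf_index l y < 2 ^ depth l" by (rule leaf_index_less)+
  then show ?case using Query by (auto split: if_splits)
qed simp

lemma card_steps_le_increments:
  fixes g :: "nat \<Rightarrow> nat"
  assumes "\<And>i. i \<in> {1..m} \<Longrightarrow> g (i - 1) \<le> g i"
    and "\<And>i. i \<in> {1..m} \<Longrightarrow> P i \<Longrightarrow> g (i - 1) \<noteq> g i"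
  shows "g 0 + card {i \<in> {1..m}. P i} \<le> g m"
  using assms
proof (induction m)
  case (Suc m)
  have IH: "g 0 + card {i \<in> {1..m}. P i} \<le> g m"
    using Suc.prems by (intro Suc.IH) auto
  have step: "g m \<le> g (Suc m)" "P (Suc m) \<Longrightarrow> g m \<noteq> g (Suc m)"
    using Suc.prems[of "Suc m"] by auto
  have "{i \<in> {1..Suc m}. P i} =
      (if P (Suc m) then insert (Suc m) {i \<in> {1..m}. P i} else {i \<in> {1..m}. P i})"
    by (auto simp: le_Suc_eq)
  then have "card {i \<in> {1..Suc m}. P i} = card {i \<in> {1..m}. P i} + (if P (Suc m) then 1 else 0)"
    by simp
  then show ?case using IH step by (auto split: if_splits)
qed simp

text \<open>Each alternation strictly raises \<open>leaf_index t\<close>, which never falls along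
  the chain and stays below \<open>2 ^ depth t\<close>. Since \<open>t\<close> is any tree for
  \<open>f\<close>, this will bound \<open>DT\<close> from below.\<close>

lemma chain_alternations_less:
  assumes "computes n t f" and "is_chain n x"
  shows "card {i \<in> {1..n}. f (x (i - 1)) \<noteq> f (x i)} < 2 ^ depth t"
proof -
  have cube: "x i \<in> cube n" if "i \<le> n" for i
    using assms(2) that by (auto simp: is_chain_def)
  have eval: "f (x i) = eval_tree t (x i)" if "i \<le> n" for i
    using assms(1) cube[OF that] by (auto simp: computes_def)
  have "leaf_index t (x 0) + card {i \<in> {1..n}. f (x (i - 1)) \<noteq> f (x i)} \<le> leaf_index t (x n)"
  proof (rule card_steps_le_increments[where g = "\<lambda>i. leaf_index t (x i)"])
    fix i assume i: "i \<in> {1..n}"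
    then have "list_all2 (\<le>) (x (i - 1)) (x i)"
      using assms(2) by (auto simp: is_chain_def strictly_below_def)
    moreover have "length (x (i - 1)) = n" using cube[of "i - 1"] i by (auto simp: cube_def)
    moreover have "set (queries t) \<subseteq> {..<n}" using assms(1) by (simp add: computes_def)
    ultimately have "\<forall>v\<in>set (queries t). x (i - 1) ! v \<le> x i ! v"
      by (auto dest: list_all2_nthD)
    then show "leaf_index t (x (i - 1)) \<le> leaf_index t (x i)" by (rule leaf_index_mono)
  next
    fix i assume i: "i \<in> {1..n}" and "f (x (i - 1)) \<noteq> f (x i)"
    moreover have "i - 1 \<le> n" "i \<le> n" using i by auto
    ultimately have "eval_tree t (x (i - 1)) \<noteq> eval_tree t (x i)" using eval by metis
    then show "leaf_index t (x (i - 1)) \<noteq> leaf_index t (x i)"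
      using eval_tree_cong_leaf_index by blast
  qed
  then show ?thesis using leaf_index_less[of t "x n"] by linarith
qed

fun inorder :: "dtree \<Rightarrow> nat list" where
  "inorder (Leaf b) = []"
| "inorder (Query i l r) = inorder l @ i # inorder r"

lemma set_inorder: "set (inorder t) = set (queries t)"
  by (induction t) auto

lemma distinct_inorder: "distinct (inorder t) = distinct (queries t)"
  by (induction t) (auto simp: set_inorder)

lemma length_inorder_full_tree: "full_tree k t \<Longrightarrow> length (inorder t) = 2 ^ k - 1"
proof (induction rule: full_tree.induct)
  case (level k l r i)
  have "(1::nat) \<le> 2 ^ k" by simp
  then show ?case using level.IH by simp
qed simp

lemma depth_full_tree: "full_tree k t \<Longrightarrow> depth t = k"
  by (induction rule: full_tree.induct) auto

lemma full_tree_pos: "full_tree k t \<Longrightarrow> k \<ge> 1"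
  by (induction rule: full_tree.induct) auto

text \<open>Such an \<open>x\<close> reaches leaf number \<open>j\<close> from the left, counted
  from 0. It is prescribed only on the queried variables, so that the hypothesis passes to
  subtrees.\<close>

lemma eval_full_tree_inorder_prefix:
  assumes "full_tree k t" and "distinct (queries t)" and "j \<le> length (inorder t)"
    and "\<forall>v\<in>set (queries t). x ! v \<longleftrightarrow> v \<in> set (take j (inorder t))"
  shows "eval_tree t x = odd j"
  using assms
proof (induction arbitrary: j rule: full_tree.induct)
  case (bottom i)
  then show ?case by (cases j) auto
next
  case (level k l r i)
  let ?m = "length (inorder l)"
  have "?m = 2 ^ k - 1" by (rule length_inorder_full_tree[OF level.hyps(1)])
  moreover have "even ((2::nat) ^ k)" using full_tree_pos[OF level.hyps(1)] by simp
  ultimately have "odd ?m" by simp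
  have prefix: "x ! v \<longleftrightarrow> v \<in> set (take j (inorder l @ i # inorder r))"
    if "v \<in> insert i (set (queries l) \<union> set (queries r))" for v
    using bspec[OF level.prems(3), of v] that by simp
  \<comment> \<open>The root has position \<open>?m\<close> in the in-order (from 0), so it is still
    0 exactly when \<open>j \<le> ?m\<close>; until then only variables of \<open>l\<close> are
    on.\<close>
  show ?case
  proof (cases "j \<le> ?m")
    case True
    have "\<not> x ! i"
      using prefix[of i] True level.prems(1) by (auto simp: set_inorder dest: in_set_takeD)
    moreover have "eval_tree l x = odd j"
      using level.prems(1) True prefix by (intro level.IH(1)) auto
    ultimately show ?thesis by simp
  next
    \<comment> \<open>The first \<open>?m + 1\<close> switches use up \<open>l\<close> and the root,
      and the other \<open>q\<close> act on \<open>r\<close>. As \<open>?m\<close> is odd,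
      \<open>j\<close> and \<open>q\<close> have the same parity.\<close>
    case False
    then obtain q where q: "j = Suc (?m + q)" using less_imp_Suc_add not_le by blast
    have "x ! i" using prefix[of i] q by simp
    moreover have "eval_tree r x = odd q"
      using level.prems(1,2) prefix q
      by (intro level.IH(2)) (auto simp: set_inorder)
    ultimately show ?thesis using q \<open>odd ?m\<close> by simp
  qed
qed

lemma is_chain_prefixes:
  assumes "distinct vs" and "set vs = {..<n}"
  shows "is_chain n (\<lambda>j. map (\<lambda>v. v \<in> set (take j vs)) [0..<n])" (is "is_chain n ?x")
proof -
  have len: "length vs = n" using distinct_card[OF assms(1)] assms(2) by simp
  have "?x (i - 1) \<prec> ?x i" if i: "i \<in> {1..n}" for i
  proof -
    obtain j where j: "i = Suc j" "j < n" using i by (cases i) auto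
    have take: "take (Suc j) vs = take j vs @ [vs ! j]" using j len by (simp add: take_Suc_conv_app_nth)
    \<comment> \<open>By distinctness the coordinate \<open>vs ! j\<close> is newly switched on,
      which makes the step strict.\<close>
    have "vs ! j \<notin> set (take j vs)"
      using distinct_take[OF assms(1), of "Suc j"] unfolding take by simp
    moreover have "vs ! j < n" using nth_mem[of j vs] assms(2) j(2) len by simp
    ultimately have "?x j ! (vs ! j) \<noteq> ?x (Suc j) ! (vs ! j)" by (simp add: take)
    then have "?x j \<noteq> ?x (Suc j)" by (rule contrapos_nn) (erule arg_cong)
    moreover have "list_all2 (\<le>) (?x j) (?x (Suc j))"
      by (auto simp: list_all2_conv_all_nth take)
    ultimately show ?thesis by (simp add: strictly_below_def j)
  qed
  moreover have "?x 0 = replicate n False" by (simp add: map_replicate_const)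
  moreover have "?x n = replicate n True"
    by (rule nth_equalityI) (simp_all add: len assms(2))
  moreover have "?x i \<in> cube n" for i by (simp add: cube_def)
  ultimately show ?thesis unfolding is_chain_def by blast
qed

lemma fully_alternating_chain:
  assumes "full_tree k t" and "distinct (queries t)" and "computes (2 ^ k - 1) t f"
  obtains x where "is_chain (2 ^ k - 1) x"
    and "{i \<in> {1..2 ^ k - 1}. f (x (i - 1)) \<noteq> f (x i)} = {1..2 ^ k - 1}"
proof -
  define n :: nat where "n = 2 ^ k - 1"
  define x where "x = (\<lambda>j. map (\<lambda>v. v \<in> set (take j (inorder t))) [0..<n])"
  have len: "length (inorder t) = n"
    unfolding n_def by (rule length_inorder_full_tree[OF assms(1)])
  have sub: "set (queries t) \<subseteq> {..<n}" using assms(3) by (simp add: computes_def n_def)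
  \<comment> \<open>By counting, the \<open>n\<close> distinct queries exhaust all coordinates;
    otherwise the prefixes would not end at the all-ones input.\<close>
  have "card (set (queries t)) = n"
    using distinct_card[of "inorder t"] assms(2) len by (simp add: set_inorder distinct_inorder)
  then have "set (inorder t) = {..<n}"
    using sub by (simp add: set_inorder card_subset_eq)
  then have chain: "is_chain n x"
    unfolding x_def using assms(2) by (intro is_chain_prefixes) (simp add: distinct_inorder)
  have parity: "f (x j) = odd j" if "j \<le> n" for j
  proof -
    have "x j \<in> cube n" by (simp add: x_def cube_def)
    then have "f (x j) = eval_tree t (x j)" using assms(3) by (simp add: computes_def n_def)
    also have "\<dots> = odd j"
      using assms(1,2) that len sub
      by (intro eval_full_tree_inorder_prefix) (auto simp: x_def subset_iff)
    finally show ?thesis .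
  qed
  have "f (x (i - 1)) \<noteq> f (x i)" if "i \<in> {1..n}" for i
  proof -
    obtain j where "i = Suc j" "j < n" using \<open>i \<in> {1..n}\<close> by (cases i) auto
    then show ?thesis using parity[of j] parity[of "Suc j"] by simp
  qed
  then show thesis using that[of x] chain unfolding n_def by blast
qed

theorem theorem6:
  fixes k :: nat and f :: "bool list \<Rightarrow> bool"
  assumes "k \<ge> 1" and "is_fk k f"
  shows "alt (2 ^ k - 1) f = 2 ^ DT (2 ^ k - 1) f - 1"
proof -
  define n :: nat where "n = 2 ^ k - 1"
  obtain t where t: "full_tree k t" "distinct (queries t)" "computes n t f"
    using assms(2) by (auto simp: is_fk_def n_def)
  obtain x where x: "is_chain n x" "{i \<in> {1..n}. f (x (i - 1)) \<noteq> f (x i)} = {1..n}"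
    using fully_alternating_chain t unfolding n_def by blast
  have "alt n f = n"
    unfolding alt_def
  proof (rule Max_eqI)
    \<comment> \<open>There are infinitely many \<open>y\<close> with \<open>is_chain n y\<close>,
      as values beyond \<open>n\<close> are free; finiteness of the set under \<open>Max\<close>
      comes from this bound instead.\<close>
    have bound: "card {i \<in> {1..n}. f (y (i - 1)) \<noteq> f (y i)} \<le> n" for y
    proof -
      have "card {i \<in> {1..n}. f (y (i - 1)) \<noteq> f (y i)} \<le> card {1..n}"
        by (rule card_mono) auto
      then show ?thesis by simp
    qed
    then show "finite {card {i \<in> {1..n}. f (y (i - 1)) \<noteq> f (y i)} | y. is_chain n y}"
      by (intro finite_subset[OF _ finite_atMost[of n]]) auto
    show "c \<le> n" if "c \<in> {card {i \<in> {1..n}. f (y (i - 1)) \<noteq> f (y i)} | y. is_chain n y}" for c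
      using that bound by auto
    have "n = card {i \<in> {1..n}. f (x (i - 1)) \<noteq> f (x i)}" unfolding x(2) by simp
    then show "n \<in> {card {i \<in> {1..n}. f (y (i - 1)) \<noteq> f (y i)} | y. is_chain n y}"
      using x(1) by blast
  qed
  moreover have "DT n f = k"
    unfolding DT_def
  proof (rule Least_equality)
    show "\<exists>t. computes n t f \<and> depth t = k" using t depth_full_tree by blast
  next
    \<comment> \<open>A tree of depth \<open>d\<close> must accommodate all \<open>2 ^ k - 1\<close>
      alternations along \<open>x\<close>.\<close>
    fix d assume "\<exists>t. computes n t f \<and> depth t = d"
    then have "card {i \<in> {1..n}. f (x (i - 1)) \<noteq> f (x i)} < 2 ^ d"
      using chain_alternations_less[OF _ x(1)] by blast
    then have "n < 2 ^ d" unfolding x(2) by simp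
    then have "(2::nat) ^ k \<le> 2 ^ d" unfolding n_def by linarith
    then show "k \<le> d" by simp
  qed
  ultimately show ?thesis by (simp add: n_def)
qed

end
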